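(* Suppose a left cancellative monoid $S$ is C$^*$-regular on the boundary and $\partial\mathcal G_P(S)=\partial\mathcal G(S)$. Then $S$ is strongly C$^*$-regular on the boundary.
   Context: $S$ is a left cancellative monoid ($st=st'\Rightarrow t=t'$). Identify $s\in S$ with the injection $S\to S$, $t\mapsto st$, and let $s^{-1}$ be the inverse partial bijection $sS\to S$. $I_\ell(S)$ is the inverse semigroup of partial bijections of $S$ generated by the left translations; its elements are the compositions $s_{2n}^{-1}s_{2n-1}\cdots s_2^{-1}s_1$. $\mathcal J(S)=\{\operatorname{dom} g: g\in I_\ell(S)\}$ is the set of constructible right ideals, a semigroup under intersection. $\bar{\mathcal J}(S)$ is obtained from $\mathcal J(S)$ by adding all sets $X\setminus\bigcup_{i=1}^mX_i$ with $X,X_i\in\mathcal J(S)$. $p_X$ is the identity map on $X\subseteq S$. "$hs=s$" means $s\in\operatorname{dom}h$ and $h(s)=s$; "$hp_Y=p_Y$" means $Y\subseteq\operatorname{dom}h$ and $h$ fixes every point of $Y$. A finite family $\{X_1,\dots,X_m\}\subseteq\bar{\mathcal J}(S)$ is a foundation set for $X\in\bar{\mathcal J}(S)$ if $X_i\subseteq X$ for all $i$ and every nonempty $Y\in\mathcal J(S)$ with $Y\subseteq X$ meets some $X_i$. $S$ is C$^*$-regular on the boundary (resp. strongly C$^*$-regular on the boundary) if, whenever $h_1,\dots,h_n\in I_\ell(S)$ and $X,X_1,\dots,X_m\in\mathcal J(S)$ ($m\ge 0$, $X_i\subseteq X$) satisfy $\emptyset\ne X\setminus\bigcup_iX_i\subseteq\bigcup_{k=1}^n\{s\in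 S: h_ks=s\}$, there are $Y_1,\dots,Y_l\in\bar{\mathcal J}(S)$ (resp. $Y_1,\dots,Y_l\in\mathcal J(S)$), $l\ge0$, and indices $1\le k_j\le n$ with $h_{k_j}p_{Y_j}=p_{Y_j}$ for all $j$ and such that $\{X_1,\dots,X_m,Y_1,\dots,Y_l\}$ is a foundation set for $X$. Characters are nonzero semigroup homomorphisms $\chi:\mathcal J(S)\to\{0,1\}$, with the topology of pointwise convergence. $\chi_s(X)=1$ iff $s\in X$. $\Omega(S)=\overline{\{\chi_s:s\in S\}}$. Each $\chi\in\Omega(S)$ extends to $\bar{\mathcal J}(S)$ by $\chi(X\setminus\bigcup_iX_i)=1$ iff $\chi(X)=1$ and $\chi(X_i)=0$ for all $i$. $\mathcal G_P(S)$ is the set of classes $[g,\chi]$ of pairs $(g,\chi)\in I_\ell(S)\times\Omega(S)$ with $\chi(\operatorname{dom}g)=1$, where $(g_1,\chi_1)\sim(g_2,\chi_2)$ iff $\chi_1=\chi_2$ and $g_1|_A=g_2|_A$ for some $A\in\mathcal J(S)$ with $\chi_1(A)=1$; it is a groupoid with product $[g,\chi][h,\psi]=[gh,\psi]$ if $\chi=\psi(h^{-1}(\cdot))$ and unit space $\Omega(S)$. $\mathcal G(S)=\mathcal G_P(S)/\sim_2$, where $[g,\chi]\sim_2[h,\chi]$ iff $g|_X=h|_X$ for some $X\in\bar{\mathcal J}(S)$ with $\chi(X)=1$. A filter on $\mathcal J(S)$ is a nonempty family of nonempty members of $\mathcal J(S)$ closed under finite intersections and upward inclusion; $\Omega_{\max}(S)\subseteq\Omega(S)$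 is the set of characters $\chi$ such that $\chi^{-1}(1)$ is a maximal filter. $\partial\Omega(S)=\overline{\Omega_{\max}(S)}$ is closed and invariant; $\partial\mathcal G_P(S)$ and $\partial\mathcal G(S)$ are the reductions of $\mathcal G_P(S)$ and $\mathcal G(S)$ to $\partial\Omega(S)$. "$\partial\mathcal G_P(S)=\partial\mathcal G(S)$" means that the quotient map $\partial\mathcal G_P(S)\to\partial\mathcal G(S)$ is injective. *)

theory Defs
  imports "HOL-Analysis.Function_Topology"
begin

text \<open>
  The monoid \<open>S\<close> is the universe of a type of class \<open>monoid_mult\<close>; left cancellation is a
  hypothesis of the theorem. Partial maps are functions \<open>'a \<rightharpoonup> 'a\<close>, composed by \<open>\<circ>\<^sub>m\<close>
  and restricted by \<open>|`\<close>; the identity \<open>p\<^sub>X\<close> of \<open>X\<close> is \<open>Some |` X\<close>.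
\<close>

definition left_translation :: "'a::monoid_mult \<Rightarrow> ('a \<rightharpoonup> 'a)" where
  "left_translation s = (\<lambda>t. Some (s * t))"

text \<open>Only meaningful for injective partial maps.\<close>

definition partial_inverse :: "('a \<rightharpoonup> 'b) \<Rightarrow> ('b \<rightharpoonup> 'a)" where
  "partial_inverse f = (\<lambda>y. if y \<in> ran f then Some (THE x. f x = Some y) else None)"

inductive_set I_l :: "('a::monoid_mult \<rightharpoonup> 'a) set" where
  translation: "left_translation s \<in> I_l"
| inverse: "g \<in> I_l \<Longrightarrow> partial_inverse g \<in> I_l"
| comp: "g \<in> I_l \<Longrightarrow> h \<in> I_l \<Longrightarrow> g \<circ>\<^sub>m h \<in> I_l"

definition constructible_ideals :: "'a::monoid_mult set set" where
  "constructible_ideals = dom ` I_l"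

text \<open>The case \<open>F = {}\<close> yields the members of \<open>constructible_ideals\<close> themselves.\<close>

definition constructible_differences :: "'a::monoid_mult set set" where
  "constructible_differences =
     {X - \<Union>F | X F. X \<in> constructible_ideals \<and> finite F \<and> F \<subseteq> constructible_ideals}"

definition foundation_set :: "'a::monoid_mult set set \<Rightarrow> 'a set \<Rightarrow> bool" where
  "foundation_set F X \<longleftrightarrow>
     X \<in> constructible_differences \<and> finite F \<and> F \<subseteq> constructible_differences \<and>
     (\<forall>Z\<in>F. Z \<subseteq> X) \<and>
     (\<forall>Y\<in>constructible_ideals. Y \<noteq> {} \<longrightarrow> Y \<subseteq> X \<longrightarrow> (\<exists>Z\<in>F. Y \<inter> Z \<noteq> {}))"

text \<open>
  The finite families \<open>h\<^sub>1, \<dots>, h\<^sub>n\<close>, \<open>X\<^sub>1, \<dots>, X\<^sub>m\<close> and \<open>Y\<^sub>1, \<dots>, Y\<^sub>l\<close> are the finite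
  sets \<open>H\<close>, \<open>F\<close> and \<open>G\<close>. The parameter \<open>\<Y>\<close> is the collection from which the \<open>Y\<^sub>j\<close> are taken.
\<close>

definition regular_on_boundary_with :: "'a::monoid_mult set set \<Rightarrow> bool" where
  "regular_on_boundary_with \<Y> \<longleftrightarrow>
     (\<forall>H X F. finite H \<longrightarrow> H \<subseteq> I_l \<longrightarrow> X \<in> constructible_ideals \<longrightarrow>
        finite F \<longrightarrow> F \<subseteq> constructible_ideals \<longrightarrow> (\<forall>Z\<in>F. Z \<subseteq> X) \<longrightarrow>
        X - \<Union>F \<noteq> {} \<longrightarrow> X - \<Union>F \<subseteq> (\<Union>h\<in>H. {s. h s = Some s}) \<longrightarrow>
        (\<exists>G. finite G \<and> G \<subseteq> \<Y> \<and>
             (\<forall>Y\<in>G. \<exists>h\<in>H. \<forall>y\<in>Y. h y = Some y) \<and>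
             foundation_set (F \<union> G) X))"

definition cstar_regular_on_boundary :: "'a::monoid_mult itself \<Rightarrow> bool" where
  "cstar_regular_on_boundary _ \<longleftrightarrow>
     regular_on_boundary_with (constructible_differences :: 'a set set)"

definition strongly_cstar_regular_on_boundary :: "'a::monoid_mult itself \<Rightarrow> bool" where
  "strongly_cstar_regular_on_boundary _ \<longleftrightarrow>
     regular_on_boundary_with (constructible_ideals :: 'a set set)"

type_synonym 'a char = "'a set \<Rightarrow> nat"

definition characters :: "'a::monoid_mult char set" where
  "characters =
     {\<chi> \<in> constructible_ideals \<rightarrow>\<^sub>E {0, 1}.
        (\<forall>X\<in>constructible_ideals. \<forall>Y\<in>constructible_ideals. \<chi> (X \<inter> Y) = \<chi> X * \<chi> Y) \<and>
        (\<exists>X\<in>constructible_ideals. \<chi> X \<noteq> 0)}"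

definition character_space :: "'a::monoid_mult char topology" where
  "character_space =
     subtopology (product_topology (\<lambda>_. discrete_topology {0, 1}) constructible_ideals) characters"

definition point_character :: "'a::monoid_mult \<Rightarrow> 'a char" where
  "point_character s = (\<lambda>X\<in>constructible_ideals. of_bool (s \<in> X))"

definition \<Omega> :: "'a::monoid_mult char set" where
  "\<Omega> = character_space closure_of (range point_character)"

text \<open>For \<open>\<chi> \<in> \<Omega>\<close> the value does not depend on how the set \<open>E\<close> is written as a difference.\<close>

definition char_extension :: "'a::monoid_mult char \<Rightarrow> 'a set \<Rightarrow> nat" where
  "char_extension \<chi> E = of_bool
     (\<exists>X F. X \<in> constructible_ideals \<and> finite F \<and> F \<subseteq> constructible_ideals \<and> E = X - \<Union>F \<and>
        \<chi> X = 1 \<and> (\<forall>Z\<in>F. \<chi> Z = 0))"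

definition ideal_filter :: "'a::monoid_mult set set \<Rightarrow> bool" where
  "ideal_filter F \<longleftrightarrow>
     F \<noteq> {} \<and> F \<subseteq> constructible_ideals \<and> {} \<notin> F \<and>
     (\<forall>X\<in>F. \<forall>Y\<in>F. X \<inter> Y \<in> F) \<and>
     (\<forall>X\<in>F. \<forall>Y\<in>constructible_ideals. X \<subseteq> Y \<longrightarrow> Y \<in> F)"

definition maximal_ideal_filter :: "'a::monoid_mult set set \<Rightarrow> bool" where
  "maximal_ideal_filter F \<longleftrightarrow>
     ideal_filter F \<and> (\<forall>F'. ideal_filter F' \<longrightarrow> F \<subseteq> F' \<longrightarrow> F' = F)"

definition \<Omega>_max :: "'a::monoid_mult char set" where
  "\<Omega>_max = {\<chi> \<in> \<Omega>. maximal_ideal_filter {X \<in> constructible_ideals. \<chi> X = 1}}"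

definition boundary_\<Omega> :: "'a::monoid_mult char set" where
  "boundary_\<Omega> = character_space closure_of \<Omega>_max"

definition germ_pairs :: "(('a::monoid_mult \<rightharpoonup> 'a) \<times> 'a char) set" where
  "germ_pairs = {(g, \<chi>). g \<in> I_l \<and> \<chi> \<in> \<Omega> \<and> \<chi> (dom g) = 1}"

definition germ_rel ::
    "((('a::monoid_mult \<rightharpoonup> 'a) \<times> 'a char) \<times> (('a \<rightharpoonup> 'a) \<times> 'a char)) set" where
  "germ_rel =
     {((g\<^sub>1, \<chi>\<^sub>1), (g\<^sub>2, \<chi>\<^sub>2)).
        (g\<^sub>1, \<chi>\<^sub>1) \<in> germ_pairs \<and> (g\<^sub>2, \<chi>\<^sub>2) \<in> germ_pairs \<and> \<chi>\<^sub>1 = \<chi>\<^sub>2 \<and>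
        (\<exists>A\<in>constructible_ideals. \<chi>\<^sub>1 A = 1 \<and> g\<^sub>1 |` A = g\<^sub>2 |` A)}"

type_synonym 'a germ = "(('a \<rightharpoonup> 'a) \<times> 'a char) set"

definition germ :: "('a::monoid_mult \<rightharpoonup> 'a) \<Rightarrow> 'a char \<Rightarrow> 'a germ" where
  "germ g \<chi> = germ_rel `` {(g, \<chi>)}"

definition G_P :: "'a::monoid_mult germ set" where
  "G_P = germ_pairs // germ_rel"

definition G_rel :: "('a::monoid_mult germ \<times> 'a germ) set" where
  "G_rel =
     {(germ g \<chi>, germ h \<chi>) | g h \<chi>.
        (g, \<chi>) \<in> germ_pairs \<and> (h, \<chi>) \<in> germ_pairs \<and>
        (\<exists>X\<in>constructible_differences. char_extension \<chi> X = 1 \<and> g |` X = h |` X)}"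

definition G_quotient_map :: "'a::monoid_mult germ \<Rightarrow> 'a germ set" where
  "G_quotient_map \<gamma> = G_rel `` {\<gamma>}"

definition G :: "'a::monoid_mult germ set set" where
  "G = G_P // G_rel"

text \<open>
  The element \<open>germ g \<chi>\<close> of the groupoid has source \<open>\<chi>\<close> and range \<open>\<chi> (g\<^sup>-\<^sup>1(\<cdot>))\<close>, where
  \<open>g\<^sup>-\<^sup>1(X)\<close> is the preimage of \<open>X\<close> under the partial map \<open>g\<close>. The reduction of a groupoid to
  a set of units consists of the elements whose source and range both lie in that set.
\<close>

definition range_char :: "('a::monoid_mult \<rightharpoonup> 'a) \<Rightarrow> 'a char \<Rightarrow> 'a char" where
  "range_char g \<chi> = (\<lambda>X\<in>constructible_ideals. \<chi> {s. \<exists>t\<in>X. g s = Some t})"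

definition boundary_G_P :: "'a::monoid_mult germ set" where
  "boundary_G_P =
     {germ g \<chi> | g \<chi>. (g, \<chi>) \<in> germ_pairs \<and> \<chi> \<in> boundary_\<Omega> \<and> range_char g \<chi> \<in> boundary_\<Omega>}"

definition boundary_G :: "'a::monoid_mult germ set set" where
  "boundary_G =
     {G_quotient_map (germ g \<chi>) | g \<chi>.
        (g, \<chi>) \<in> germ_pairs \<and> \<chi> \<in> boundary_\<Omega> \<and> range_char g \<chi> \<in> boundary_\<Omega>}"

lemma boundary_G_P_subset: "boundary_G_P \<subseteq> G_P"
  by (auto simp: boundary_G_P_def G_P_def germ_def intro: quotientI)

lemma boundary_G_subset: "boundary_G \<subseteq> G"
  using boundary_G_P_subset
  by (force simp: boundary_G_def boundary_G_P_def G_def G_quotient_map_def intro: quotientI)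

lemma G_quotient_map_boundary: "G_quotient_map ` boundary_G_P = boundary_G"
  by (auto simp: boundary_G_def boundary_G_P_def)

text \<open>
  Equality of the two boundary groupoids: the quotient map between them, which is always
  surjective, is injective.
\<close>

definition boundary_groupoids_equal :: "'a::monoid_mult itself \<Rightarrow> bool" where
  "boundary_groupoids_equal _ \<longleftrightarrow> inj_on G_quotient_map (boundary_G_P :: 'a germ set)"

end

theory Submission
  imports Defs
begin

text \<open>
  Let \<open>\<chi>\<close> be a boundary character with \<open>\<chi>(X) = 1\<close> and \<open>\<chi>(X\<^sub>i) = 0\<close> for all \<open>i\<close>. Regularity on
  the boundary gives \<open>j\<close> with \<open>\<chi>(Y\<^sub>j) = 1\<close>, so the germ of \<open>h\<close> with \<open>h p\<^sub>Y = p\<^sub>Y\<close>, \<open>Y = Y\<^sub>j\<close>, is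
  identified with a unit in the quotient groupoid. By injectivity of the quotient map
  it already is a unit, i.e. \<open>h\<close> is the identity on some constructible ideal \<open>A\<close> with
  \<open>\<chi>(A) = 1\<close>. Compactness of the boundary leaves finitely many of these ideals \<open>A\<close>, and they
  complete the \<open>X\<^sub>i\<close> to a foundation set, because every nonempty constructible ideal lies in
  a maximal filter, which is a boundary character.
\<close>

section \<open>Partial bijections, constructible ideals and extended characters\<close>

lemma left_translation_1: "left_translation (1::'a::monoid_mult) = Some"
  by (simp add: left_translation_def)

lemma Some_in_I_l: "(Some :: 'a::monoid_mult \<rightharpoonup> 'a) \<in> I_l"
  using I_l.translation[of "1::'a"] by (simp add: left_translation_1)

lemma UNIV_constructible: "(UNIV :: 'a::monoid_mult set) \<in> constructible_ideals"
  unfolding constructible_ideals_def using Some_in_I_l by (force simp: dom_def)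

lemma dom_constructible: "g \<in> I_l \<Longrightarrow> dom g \<in> constructible_ideals"
  by (simp add: constructible_ideals_def)

text \<open>Injectivity makes the \<open>THE\<close> in \<open>partial_inverse\<close> denote the
  unique preimage.\<close>

lemma partial_inverse_eq_Some:
  assumes "\<And>x x' y. f x = Some y \<Longrightarrow> f x' = Some y \<Longrightarrow> x = x'"
  shows "partial_inverse f y = Some x \<longleftrightarrow> f x = Some y"
proof -
  have "(THE x. f x = Some y) = x" if "f x = Some y" for x
    using assms that by blast
  then show ?thesis
    by (auto simp: partial_inverse_def ran_def)
qed

lemma constructible_difference:
  "X \<in> constructible_ideals \<Longrightarrow> finite F \<Longrightarrow> F \<subseteq> constructible_ideals \<Longrightarrow>
   X - \<Union>F \<in> constructible_differences"
  by (auto simp: constructible_differences_def)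

lemma constructible_ideals_subset_differences:
  "constructible_ideals \<subseteq> constructible_differences"
  using constructible_difference[of _ "{}"] by auto

lemma char_extension_eq_1:
  "char_extension \<chi> E = 1 \<longleftrightarrow>
    (\<exists>X F. X \<in> constructible_ideals \<and> finite F \<and> F \<subseteq> constructible_ideals \<and> E = X - \<Union>F \<and>
       \<chi> X = 1 \<and> (\<forall>Z\<in>F. \<chi> Z = 0))"
  by (simp only: char_extension_def of_bool_eq_1_iff)

lemma char_extension_ideal:
  "X \<in> constructible_ideals \<Longrightarrow> \<chi> X = 1 \<Longrightarrow> char_extension \<chi> X = 1"
  unfolding char_extension_eq_1 by (intro exI[of _ X] exI[of _ "{}"]) simp

lemma restrict_map_eq_mono:
  assumes "g |` A = h |` A" "B \<subseteq> A"
  shows "g |` B = h |` B"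
proof -
  have "(g |` A) |` B = (h |` A) |` B"
    by (simp only: assms(1))
  then show ?thesis
    by (simp add: Int_absorb1 assms(2))
qed

section \<open>The topology of the character space\<close>

lemma characters_value:
  "\<chi> \<in> characters \<Longrightarrow> X \<in> constructible_ideals \<Longrightarrow> \<chi> X = 0 \<or> \<chi> X = 1"
  by (auto simp: characters_def PiE_iff)

lemma characters_Int:
  "\<chi> \<in> characters \<Longrightarrow> X \<in> constructible_ideals \<Longrightarrow> Y \<in> constructible_ideals \<Longrightarrow>
   \<chi> (X \<inter> Y) = \<chi> X * \<chi> Y"
  by (auto simp: characters_def)

text \<open>Multiplicativity at \<open>X \<inter> UNIV = X\<close>, for an \<open>X\<close> with
  nonzero value. Being nonzero thereby becomes a condition on one coordinate.\<close>

lemma characters_UNIV: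
  assumes "\<chi> \<in> characters"
  shows "\<chi> (UNIV :: 'a::monoid_mult set) = 1"
proof -
  obtain X where X: "X \<in> constructible_ideals" "\<chi> X \<noteq> 0"
    using assms by (auto simp: characters_def)
  have "\<chi> X = \<chi> X * \<chi> UNIV"
    using characters_Int[OF assms X(1) UNIV_constructible] by simp
  with X show ?thesis by simp
qed

lemma topspace_character_space: "topspace character_space = characters"
  by (auto simp: character_space_def characters_def)

lemma openin_character_value:
  assumes "X \<in> constructible_ideals"
  shows "openin character_space {\<chi> \<in> characters. \<chi> X = e}"
proof -
  let ?P = "product_topology (\<lambda>_. discrete_topology {0, 1::nat}) constructible_ideals"
  \<comment> \<open>\<open>e\<close> is any number, but open sets of the factors are subsets of {0,
    1}; on characters the intersection changes nothing.\<close>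
  have "openin ?P {\<chi> \<in> topspace ?P. \<chi> X \<in> {e} \<inter> {0, 1}}"
    by (rule openin_continuous_map_preimage[OF continuous_map_product_projection[OF assms]]) auto
  then have "openin character_space ({\<chi> \<in> topspace ?P. \<chi> X \<in> {e} \<inter> {0, 1}} \<inter> characters)"
    unfolding character_space_def by (rule openin_subtopology_Int)
  moreover have "{\<chi> \<in> topspace ?P. \<chi> X \<in> {e} \<inter> {0, 1}} \<inter> characters = {\<chi> \<in> characters. \<chi> X = e}"
    using assms by (auto simp: characters_def)
  ultimately show ?thesis by simp
qed

lemma openin_character_values:
  assumes "finite I" "I \<subseteq> constructible_ideals"
  shows "openin character_space {\<psi> \<in> characters. \<forall>X\<in>I. \<psi> X = \<chi> X}"
  using assms
proof (induction I)
  case empty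
  show ?case
    using openin_topspace[of character_space] by (simp add: topspace_character_space)
next
  case (insert X I)
  have "{\<psi> \<in> characters. \<forall>Y\<in>insert X I. \<psi> Y = \<chi> Y} =
      {\<psi> \<in> characters. \<psi> X = \<chi> X} \<inter> {\<psi> \<in> characters. \<forall>Y\<in>I. \<psi> Y = \<chi> Y}"
    by auto
  with insert openin_character_value[of X "\<chi> X"] show ?case
    by (simp add: openin_Int)
qed

text \<open>Boxes restricting finitely many coordinates form a base of the product topology, and
  with discrete factors such a box can be shrunk to prescribing the values of \<open>\<chi>\<close>
  on those coordinates.\<close>

lemma closure_of_character_space:
  assumes "A \<subseteq> characters"
  shows "\<chi> \<in> character_space closure_of A \<longleftrightarrow>
    \<chi> \<in> characters \<and>
    (\<forall>I. finite I \<longrightarrow> I \<subseteq> constructible_ideals \<longrightarrow> (\<exists>\<psi>\<in>A. \<forall>X\<in>I. \<psi> X = \<chi> X))"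
    (is "?L \<longleftrightarrow> ?R")
proof
  assume L: ?L
  then have \<chi>: "\<chi> \<in> characters"
    by (auto simp: in_closure_of topspace_character_space)
  show ?R
  proof (intro conjI allI impI \<chi>)
    fix I :: "'a set set"
    assume I: "finite I" "I \<subseteq> constructible_ideals"
    let ?U = "{\<psi> \<in> characters. \<forall>X\<in>I. \<psi> X = \<chi> X}"
    have "\<chi> \<in> ?U \<and> openin character_space ?U"
      using \<chi> openin_character_values[OF I, of \<chi>] by simp
    then obtain \<psi> where "\<psi> \<in> A \<and> \<psi> \<in> ?U"
      using L[unfolded in_closure_of, THEN conjunct2, THEN spec[of _ ?U]] by (elim impE exE)
    then show "\<exists>\<psi>\<in>A. \<forall>X\<in>I. \<psi> X = \<chi> X" by blast
  qed
next
  assume R: ?R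
  show ?L
    unfolding in_closure_of topspace_character_space
  proof (intro conjI allI impI)
    show "\<chi> \<in> characters" using R by simp
    fix T
    assume T: "\<chi> \<in> T \<and> openin character_space T"
    then obtain U where
      U: "openin (product_topology (\<lambda>_. discrete_topology {0, 1}) constructible_ideals) U"
        "T = U \<inter> characters"
      unfolding character_space_def openin_subtopology by blast
    with T have "\<chi> \<in> U" by auto
    with U(1) obtain V where V: "finite {i \<in> constructible_ideals. V i \<noteq> {0, 1}}"
        "\<chi> \<in> Pi\<^sub>E constructible_ideals V" "Pi\<^sub>E constructible_ideals V \<subseteq> U"
      unfolding openin_product_topology_alt topspace_discrete_topology by meson
    have "{i \<in> constructible_ideals. V i \<noteq> {0, 1}} \<subseteq> constructible_ideals" by blast
    with R V(1) have "\<exists>\<psi>\<in>A. \<forall>X\<in>{i \<in> constructible_ideals. V i \<noteq> {0, 1}}. \<psi> X = \<chi> X"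
      by meson
    then obtain \<psi> where \<psi>: "\<psi> \<in> A" "\<And>X. X \<in> constructible_ideals \<Longrightarrow> V X \<noteq> {0, 1} \<Longrightarrow> \<psi> X = \<chi> X"
      by blast
    have \<psi>c: "\<psi> \<in> characters" using \<psi>(1) assms by auto
    have "\<psi> X \<in> V X" if "X \<in> constructible_ideals" for X
      using characters_value[OF \<psi>c that] \<psi>(2)[OF that]
        PiE_mem[OF V(2) that]
      by (cases "V X = {0, 1}") auto
    then have "\<psi> \<in> Pi\<^sub>E constructible_ideals V"
      using \<psi>c by (simp add: characters_def PiE_iff)
    then show "\<exists>y. y \<in> A \<and> y \<in> T"
      using V(3) U(2) \<psi>(1) \<psi>c by blast
  qed
qed

lemma point_character_apply:
  "X \<in> constructible_ideals \<Longrightarrow> point_character s X = of_bool (s \<in> X)"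
  by (simp add: point_character_def)

lemma boundary_subset_Omega: "boundary_\<Omega> \<subseteq> \<Omega>"
proof -
  have "character_space closure_of \<Omega>_max \<subseteq> character_space closure_of \<Omega>"
    by (rule closure_of_mono) (auto simp: \<Omega>_max_def)
  then show ?thesis
    by (simp add: boundary_\<Omega>_def \<Omega>_def)
qed

lemma Omega_subset_characters: "\<Omega> \<subseteq> characters"
  unfolding \<Omega>_def using closure_of_subset_topspace topspace_character_space by metis

lemma Omega_max_subset_boundary: "\<Omega>_max \<subseteq> boundary_\<Omega>"
  unfolding boundary_\<Omega>_def
  by (rule closure_of_subset)
    (use Omega_subset_characters in \<open>auto simp: \<Omega>_max_def topspace_character_space\<close>)

lemma ideal_filterD:
  assumes "ideal_filter M"
  shows "M \<noteq> {}" "M \<subseteq> constructible_ideals" "{} \<notin> M"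
    "X \<in> M \<Longrightarrow> Y \<in> M \<Longrightarrow> X \<inter> Y \<in> M"
    "X \<in> M \<Longrightarrow> Y \<in> constructible_ideals \<Longrightarrow> X \<subseteq> Y \<Longrightarrow> Y \<in> M"
  using assms unfolding ideal_filter_def by simp_all

text \<open>The factor \<open>X\<close> starts the induction: for empty \<open>C\<close> the
  intersection is \<open>X\<close> itself.\<close>

lemma ideal_filter_Inter:
  assumes "ideal_filter M" "finite C" "C \<subseteq> M" "X \<in> M"
  shows "X \<inter> \<Inter>C \<in> M"
  using assms(2,3)
proof (induction C)
  case (insert A C)
  then have "A \<inter> (X \<inter> \<Inter>C) \<in> M"
    using ideal_filterD(4)[OF assms(1)] by simp
  then show ?case by (simp add: Int_left_commute)
qed (use assms(4) in simp)

section \<open>Consequences of left cancellation for constructible ideals\<close>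

context
  assumes left_cancellative: "\<And>s t t' :: 'a::monoid_mult. s * t = s * t' \<Longrightarrow> t = t'"
begin

text \<open>Left cancellation is injectivity of the translations; inverses and compositions inherit
  it.\<close>

lemma I_l_injective:
  assumes "(g :: 'a \<rightharpoonup> 'a) \<in> I_l" "g x = Some y" "g x' = Some y"
  shows "x = x'"
  using assms
proof (induction g arbitrary: x x' y rule: I_l.induct)
  case (translation s)
  then have "s * x = s * x'"
    by (simp add: left_translation_def)
  then show ?case
    by (rule left_cancellative)
next
  case (inverse g)
  have "partial_inverse g y = Some x \<longleftrightarrow> g x = Some y" for x y
    by (rule partial_inverse_eq_Some) (rule inverse.IH)
  with inverse.prems show ?case by simp
next
  case (comp g h)
  obtain z z' where "h x = Some z" "g z = Some y" "h x' = Some z'" "g z' = Some y"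
    using comp.prems by (auto simp: map_comp_Some_iff)
  then show ?case
    using comp.IH(1)[of z y z'] comp.IH(2)[of x z x'] by simp
qed

text \<open>An ideal is \<open>dom g\<close> for some \<open>g\<close> in \<open>I_l\<close>, and
  \<open>partial_inverse g\<close> composed with \<open>g\<close> is the identity of
  \<open>dom g\<close>.\<close>

lemma restrict_Some_in_I_l:
  assumes "X \<in> constructible_ideals"
  shows "Some |` X \<in> (I_l :: ('a \<rightharpoonup> 'a) set)"
proof -
  obtain g where g: "g \<in> I_l" "X = dom g"
    using assms by (auto simp: constructible_ideals_def)
  have inv: "partial_inverse g y = Some x \<longleftrightarrow> g x = Some y" for x y
    by (rule partial_inverse_eq_Some) (rule I_l_injective[OF g(1)])
  have "(partial_inverse g \<circ>\<^sub>m g) x = (Some |` X) x" for x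
    using inv by (cases "g x") (auto simp: map_comp_def restrict_map_def g(2) domIff)
  then have "partial_inverse g \<circ>\<^sub>m g = Some |` X" ..
  then show ?thesis
    using I_l.comp[OF I_l.inverse[OF g(1)] g(1)] by simp
qed

text \<open>The preimage is the domain of the identity of \<open>X\<close> composed with
  \<open>g\<close>.\<close>

lemma preimage_constructible:
  assumes "(g :: 'a \<rightharpoonup> 'a) \<in> I_l" "X \<in> constructible_ideals"
  shows "{s. \<exists>t\<in>X. g s = Some t} \<in> constructible_ideals"
proof -
  have "dom ((Some |` X) \<circ>\<^sub>m g) = {s. \<exists>t\<in>X. g s = Some t}"
    by (auto simp: dom_def map_comp_Some_iff restrict_map_def split: if_splits)
  then show ?thesis
    using dom_constructible[OF I_l.comp[OF restrict_Some_in_I_l[OF assms(2)] assms(1)]] by simp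
qed

lemma Int_constructible:
  assumes "X \<in> constructible_ideals" "Y \<in> constructible_ideals"
  shows "X \<inter> Y \<in> (constructible_ideals :: 'a set set)"
proof -
  have "{s. \<exists>t\<in>Y. (Some |` X) s = Some t} = X \<inter> Y"
    by (auto simp: restrict_map_def split: if_splits)
  then show ?thesis
    using preimage_constructible[OF restrict_Some_in_I_l[OF assms(1)] assms(2)] by simp
qed

section \<open>Points, \<open>\<Omega>\<close> and compactness\<close>

lemma point_character_in_characters: "point_character (s::'a) \<in> characters"
  using UNIV_constructible Int_constructible
  by (auto simp: characters_def point_character_def)

lemma mem_Omega_iff:
  "(\<chi> :: 'a char) \<in> \<Omega> \<longleftrightarrow> \<chi> \<in> characters \<and>
    (\<forall>I. finite I \<longrightarrow> I \<subseteq> constructible_ideals \<longrightarrow> (\<exists>s. \<forall>X\<in>I. of_bool (s \<in> X) = \<chi> X))"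
proof -
  have "range (point_character :: 'a \<Rightarrow> _) \<subseteq> characters"
    using point_character_in_characters by auto
  note * = closure_of_character_space[OF this, of \<chi>]
  have cyl: "(\<exists>\<psi>\<in>range point_character. \<forall>X\<in>I. \<psi> X = \<chi> X) \<longleftrightarrow> (\<exists>s. \<forall>X\<in>I. of_bool (s \<in> X) = \<chi> X)"
    if "I \<subseteq> constructible_ideals" for I
  proof -
    have "(\<forall>X\<in>I. point_character s X = \<chi> X) \<longleftrightarrow> (\<forall>X\<in>I. of_bool (s \<in> X) = \<chi> X)" for s
      using that by (intro ball_cong) (auto simp: point_character_apply)
    then show ?thesis by auto
  qed
  show ?thesis
    unfolding \<Omega>_def * by (intro conj_cong all_cong1 imp_cong refl cyl)
qed

text \<open>Tychonoff gives compactness of the product, and the characters are closed in it, because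
  failing to be a character is visible on finitely many coordinates.\<close>

lemma compact_space_character_space: "compact_space (character_space :: 'a char topology)"
proof -
  let ?J = "constructible_ideals :: 'a set set"
  let ?P = "product_topology (\<lambda>_. discrete_topology {0, 1::nat}) ?J"
  have P: "compact_space ?P"
    by (simp add: compact_space_product_topology compact_space_discrete_topology)
  have cyl: "openin ?P {\<chi> \<in> topspace ?P. \<chi> X \<in> E}"
    if "X \<in> ?J" "E \<subseteq> {0, 1}" for X E
    by (rule openin_continuous_map_preimage[OF continuous_map_product_projection[OF that(1)]])
      (use that(2) in auto)
  have "openin ?P (topspace ?P - characters)"
  proof (subst openin_subopen, intro ballI)
    fix \<chi>
    assume \<chi>: "\<chi> \<in> topspace ?P - characters"
    show "\<exists>T. openin ?P T \<and> \<chi> \<in> T \<and> T \<subseteq> topspace ?P - characters"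
    \<comment> \<open>If the value at \<open>UNIV\<close> is not 0, then \<open>\<chi>\<close> is
      nonzero, so multiplicativity must fail at some pair of ideals.\<close>
    proof (cases "\<chi> UNIV = 0")
      case True
      then show ?thesis
        using cyl[of UNIV "{0}"] \<chi> characters_UNIV UNIV_constructible
        by (intro exI[of _ "{\<psi> \<in> topspace ?P. \<psi> UNIV \<in> {0}}"]) force
    next
      case False
      then obtain X Y where XY: "X \<in> ?J" "Y \<in> ?J" "\<chi> (X \<inter> Y) \<noteq> \<chi> X * \<chi> Y"
        using \<chi> UNIV_constructible by (auto simp: characters_def)
      let ?C = "\<lambda>Z. {\<psi> \<in> topspace ?P. \<psi> Z \<in> {\<chi> Z}}"
      have C: "openin ?P (?C Z)" if "Z \<in> ?J" for Z
        using \<chi> that by (intro cyl) (auto simp: PiE_iff)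
      have "openin ?P (?C X \<inter> ?C Y \<inter> ?C (X \<inter> Y))"
        using C XY Int_constructible by (intro openin_Int) auto
      moreover have "?C X \<inter> ?C Y \<inter> ?C (X \<inter> Y) \<subseteq> topspace ?P - characters"
        using XY characters_Int[OF _ XY(1,2)] by force
      ultimately show ?thesis
        using \<chi> by (intro exI[of _ "?C X \<inter> ?C Y \<inter> ?C (X \<inter> Y)"]) auto
    qed
  qed
  moreover have "characters \<subseteq> topspace ?P"
    by (auto simp: characters_def)
  ultimately have "closedin ?P characters"
    by (simp add: closedin_def)
  then show ?thesis
    unfolding character_space_def
    by (intro compact_space_subtopology closedin_compact_space P)
qed

text \<open>The pair \<open>(X, e)\<close> stands for the open set of characters with value
  \<open>e\<close> at \<open>X\<close>. The boundary is closed in a compact space.\<close>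

lemma boundary_finite_subcover:
  fixes P :: "('a set \<times> nat) set"
  assumes P: "fst ` P \<subseteq> constructible_ideals"
    and cover: "\<forall>\<chi>\<in>boundary_\<Omega>. \<exists>(X, e)\<in>P. \<chi> X = e"
  shows "\<exists>Q. finite Q \<and> Q \<subseteq> P \<and> (\<forall>\<chi>\<in>boundary_\<Omega>. \<exists>(X, e)\<in>Q. \<chi> X = e)"
proof -
  let ?U = "\<lambda>(X, e). {\<chi> \<in> characters. \<chi> X = e}"
  have "compactin character_space (boundary_\<Omega> :: 'a char set)"
    unfolding boundary_\<Omega>_def
    by (rule closedin_compact_space[OF compact_space_character_space closedin_closure_of])
  moreover have "\<forall>U\<in>?U ` P. openin character_space U"
    using P by (auto intro!: openin_character_value)
  moreover have "boundary_\<Omega> \<subseteq> \<Union>(?U ` P)"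
    using cover boundary_subset_Omega Omega_subset_characters by fastforce
  ultimately obtain \<F> where \<F>: "finite \<F>" "\<F> \<subseteq> ?U ` P" "boundary_\<Omega> \<subseteq> \<Union>\<F>"
    unfolding compactin_def by meson
  then obtain Q where Q: "Q \<subseteq> P" "finite Q" "\<F> = ?U ` Q"
    by (meson finite_subset_image)
  have "\<exists>(X, e)\<in>Q. \<chi> X = e" if "\<chi> \<in> boundary_\<Omega>" for \<chi>
    using \<F>(3) that unfolding Q(3) by fastforce
  with Q(1,2) show ?thesis by blast
qed

section \<open>Maximal filters and their characters\<close>

lemma ideal_filter_generated:
  assumes M: "ideal_filter M" and B: "(B :: 'a set) \<in> constructible_ideals"
    and "\<And>A. A \<in> M \<Longrightarrow> A \<inter> B \<noteq> {}"
  shows "ideal_filter {Z \<in> constructible_ideals. \<exists>A\<in>M. A \<inter> B \<subseteq> Z}" (is "ideal_filter ?N")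
  unfolding ideal_filter_def
proof (intro conjI ballI impI)
  show "?N \<noteq> {}" using ideal_filterD(1)[OF M] B by blast
  show "{} \<notin> ?N" using assms(3) by auto
  show "X \<inter> Y \<in> ?N" if X: "X \<in> ?N" and Y: "Y \<in> ?N" for X Y
  proof -
    obtain A A' where A: "A \<in> M" "A \<inter> B \<subseteq> X" "A' \<in> M" "A' \<inter> B \<subseteq> Y"
      using X Y by auto
    then have "A \<inter> A' \<in> M" "(A \<inter> A') \<inter> B \<subseteq> X \<inter> Y"
      using ideal_filterD(4)[OF M] by auto
    with X Y show ?thesis
      using Int_constructible by blast
  qed
qed auto

text \<open>Otherwise \<open>M\<close> and \<open>B\<close> would generate a filter, which by
  maximality is \<open>M\<close>.\<close>

lemma maximal_ideal_filter_disjoint: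
  assumes "maximal_ideal_filter M" "(B :: 'a set) \<in> constructible_ideals" "B \<notin> M"
  shows "\<exists>A\<in>M. A \<inter> B = {}"
proof (rule ccontr)
  assume "\<not> ?thesis"
  moreover have M: "ideal_filter M"
    using assms(1) by (simp add: maximal_ideal_filter_def)
  ultimately have "ideal_filter {Z \<in> constructible_ideals. \<exists>A\<in>M. A \<inter> B \<subseteq> Z}"
    using ideal_filter_generated assms(2) by blast
  moreover have "M \<subseteq> {Z \<in> constructible_ideals. \<exists>A\<in>M. A \<inter> B \<subseteq> Z}"
    using ideal_filterD(2)[OF M] by blast
  ultimately have "{Z \<in> constructible_ideals. \<exists>A\<in>M. A \<inter> B \<subseteq> Z} = M"
    using assms(1) by (simp add: maximal_ideal_filter_def)
  then show False
    using assms(2,3) ideal_filterD(1)[OF M] by blast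
qed

text \<open>Intersecting \<open>X\<close> with one witness of disjointness for each \<open>B\<close>
  gives \<open>Y\<close>. The first alternative serves sets that need not be ideals, such as members
  of a foundation set.\<close>

lemma maximal_ideal_filter_avoids:
  assumes M: "maximal_ideal_filter M" and "X \<in> M" "finite C"
    and "\<And>B. B \<in> C \<Longrightarrow> (\<exists>A\<in>M. A \<inter> B = {}) \<or> (B :: 'a set) \<in> constructible_ideals - M"
  obtains Y where "Y \<in> M" "Y \<subseteq> X" "\<And>B. B \<in> C \<Longrightarrow> Y \<inter> B = {}"
proof -
  have "\<forall>B\<in>C. \<exists>A\<in>M. A \<inter> B = {}"
    using assms(4) maximal_ideal_filter_disjoint[OF M] by blast
  then obtain a where a: "\<And>B. B \<in> C \<Longrightarrow> a B \<in> M \<and> a B \<inter> B = {}"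
    by metis
  show thesis
  proof (rule that)
    show "X \<inter> \<Inter>(a ` C) \<in> M"
      using M a assms(2,3)
      by (intro ideal_filter_Inter) (auto simp: maximal_ideal_filter_def)
    show "X \<inter> \<Inter>(a ` C) \<inter> B = {}" if "B \<in> C" for B
      using a[OF that] that by blast
  qed auto
qed

text \<open>Zorn's lemma for the filters containing \<open>Y\<close>, with the ideals above
  \<open>Y\<close> as an initial example.\<close>

lemma exists_maximal_ideal_filter:
  assumes Y: "(Y :: 'a set) \<in> constructible_ideals" "Y \<noteq> {}"
  obtains M where "maximal_ideal_filter M" "Y \<in> M"
proof -
  let ?A = "{M. ideal_filter M \<and> Y \<in> M}"
  have "{Z \<in> constructible_ideals. Y \<subseteq> Z} \<in> ?A"
    using Y Int_constructible by (auto simp: ideal_filter_def)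
  then have "?A \<noteq> {}" by blast
  moreover have "\<Union>\<C> \<in> ?A" if "\<C> \<noteq> {}" and C: "subset.chain ?A \<C>" for \<C>
  proof -
    have sub: "\<C> \<subseteq> ?A" and lin: "\<And>M N. M \<in> \<C> \<Longrightarrow> N \<in> \<C> \<Longrightarrow> M \<subseteq> N \<or> N \<subseteq> M"
      using C by (auto simp: subset_chain_def)
    have "ideal_filter (\<Union>\<C>)"
      unfolding ideal_filter_def
    proof (intro conjI ballI impI)
      show "\<Union>\<C> \<noteq> {}" using sub \<open>\<C> \<noteq> {}\<close> by auto
      show "\<Union>\<C> \<subseteq> constructible_ideals" using sub ideal_filterD(2) by blast
      show "{} \<notin> \<Union>\<C>" using sub ideal_filterD(3) by blast
      show "Z \<in> \<Union>\<C>" if "X \<in> \<Union>\<C>" "Z \<in> constructible_ideals" "X \<subseteq> Z" for X Z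
        using that sub ideal_filterD(5) by blast
      show "X \<inter> Z \<in> \<Union>\<C>" if XZ: "X \<in> \<Union>\<C>" "Z \<in> \<Union>\<C>" for X Z
      proof -
        obtain M where "M \<in> \<C>" "X \<in> M" "Z \<in> M"
          using XZ lin by blast
        then show ?thesis
          using sub ideal_filterD(4) by blast
      qed
    qed
    with sub \<open>\<C> \<noteq> {}\<close> show ?thesis by auto
  qed
  ultimately obtain M where M: "M \<in> ?A" "\<And>N. N \<in> ?A \<Longrightarrow> M \<subseteq> N \<Longrightarrow> N = M"
    using subset_Zorn_nonempty[of ?A] by blast
  \<comment> \<open>A filter that includes \<open>M\<close> has \<open>Y\<close> as a member too, so
    it competes in \<open>?A\<close>.\<close>
  then have "maximal_ideal_filter M"
    by (auto simp: maximal_ideal_filter_def)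
  with M show thesis
    by (intro that) auto
qed

text \<open>The point is membership in \<open>\<Omega>\<close>: given finitely many ideals, some
  member of \<open>M\<close> lies in those belonging to \<open>M\<close> and misses the others, so
  each of its points realizes \<open>\<chi>\<close> on all of them.\<close>

lemma maximal_ideal_filter_character:
  assumes M: "maximal_ideal_filter (M :: 'a set set)"
  defines "\<chi> \<equiv> \<lambda>X\<in>constructible_ideals. of_bool (X \<in> M) :: nat"
  shows "\<chi> \<in> \<Omega>_max"
proof -
  have F: "ideal_filter M"
    using M by (simp add: maximal_ideal_filter_def)
  have Int: "X \<inter> Y \<in> M \<longleftrightarrow> X \<in> M \<and> Y \<in> M"
    if "X \<in> constructible_ideals" "Y \<in> constructible_ideals" for X Y
    using ideal_filterD(4)[OF F] ideal_filterD(5)[OF F, of "X \<inter> Y"] that by blast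
  have U: "UNIV \<in> M"
    using ideal_filterD(1)[OF F] ideal_filterD(5)[OF F _ UNIV_constructible] by blast
  have "\<chi> \<in> characters"
    using Int U Int_constructible UNIV_constructible
    by (auto simp: characters_def \<chi>_def)
  moreover have "\<exists>s. \<forall>X\<in>I. of_bool (s \<in> X) = \<chi> X"
    if I: "finite I" "I \<subseteq> constructible_ideals" for I
  proof -
    have "UNIV \<inter> \<Inter>(I \<inter> M) \<in> M"
      by (rule ideal_filter_Inter[OF F _ _ U]) (use I in auto)
    then obtain Y where "Y \<in> M" "Y \<subseteq> \<Inter>(I \<inter> M)" "\<And>B. B \<in> I - M \<Longrightarrow> Y \<inter> B = {}"
      using maximal_ideal_filter_avoids[OF M, of "\<Inter>(I \<inter> M)" "I - M"] I by auto
    moreover from this obtain s where "s \<in> Y"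
      using ideal_filterD(3)[OF F] by fastforce
    ultimately have "s \<in> X \<longleftrightarrow> X \<in> M" if "X \<in> I" for X
      using that by blast
    then show ?thesis
      using I by (intro exI[of _ s]) (auto simp: \<chi>_def)
  qed
  moreover have "{X \<in> constructible_ideals. \<chi> X = 1} = M"
    using ideal_filterD(2)[OF F] by (auto simp: \<chi>_def)
  ultimately show ?thesis
    using M by (simp add: \<Omega>_max_def mem_Omega_iff)
qed

section \<open>Foundation sets and boundary characters\<close>

text \<open>A character in \<open>\<Omega>_max\<close> approximating \<open>\<chi>\<close> has a
  maximal filter \<open>M\<close>. If the claim failed, every member of \<open>F \<union> G\<close>
  would be missed by a member of \<open>M\<close>, and so one nonempty ideal inside \<open>X\<close>
  would miss them all.\<close>

lemma foundation_set_boundary: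
  fixes F G :: "'a set set"
  assumes fs: "foundation_set (F \<union> G) X"
    and X: "X \<in> constructible_ideals" and F: "F \<subseteq> constructible_ideals"
    and \<chi>: "\<chi> \<in> boundary_\<Omega>" "\<chi> X = 1" "\<And>Z. Z \<in> F \<Longrightarrow> \<chi> Z = 0"
  shows "\<exists>Y\<in>G. char_extension \<chi> Y = 1"
proof -
  have fin: "finite F" "finite G"
    using fs by (auto simp: foundation_set_def)
  have "G \<subseteq> constructible_differences"
    using fs by (simp add: foundation_set_def)
  then have "\<forall>Y\<in>G. \<exists>Z C. Z \<in> constructible_ideals \<and> finite C \<and> C \<subseteq> constructible_ideals \<and> Y = Z - \<Union>C"
    unfolding constructible_differences_def by blast
  then obtain z c where "\<forall>Y\<in>G.
      z Y \<in> constructible_ideals \<and> finite (c Y) \<and> c Y \<subseteq> constructible_ideals \<and> Y = z Y - \<Union>(c Y)"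
    by metis
  then have zc: "\<And>Y. Y \<in> G \<Longrightarrow> z Y \<in> constructible_ideals" "\<And>Y. Y \<in> G \<Longrightarrow> finite (c Y)"
      "\<And>Y. Y \<in> G \<Longrightarrow> c Y \<subseteq> constructible_ideals"
    and eq: "\<And>Y. Y \<in> G \<Longrightarrow> Y = z Y - \<Union>(c Y)"
    by blast+
  \<comment> \<open>These finitely many ideals decide all values in question, so a maximal character
    agreeing with \<open>\<chi>\<close> on them can replace it.\<close>
  define I where "I = insert X (F \<union> z ` G \<union> \<Union>(c ` G))"
  have I: "finite I" "I \<subseteq> constructible_ideals"
    using fin zc X F by (auto simp: I_def)
  have "\<Omega>_max \<subseteq> (characters :: 'a char set)"
    using Omega_subset_characters by (auto simp: \<Omega>_max_def)
  from closure_of_character_space[OF this, of \<chi>]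
  have "\<forall>I. finite I \<longrightarrow> I \<subseteq> constructible_ideals \<longrightarrow> (\<exists>\<psi>\<in>\<Omega>_max. \<forall>A\<in>I. \<psi> A = \<chi> A)"
    using \<chi>(1) unfolding boundary_\<Omega>_def by simp
  then obtain \<psi> where \<psi>: "\<psi> \<in> \<Omega>_max" "\<forall>A\<in>I. \<psi> A = \<chi> A"
    using I by blast
  define M where "M = {X \<in> constructible_ideals. \<psi> X = 1}"
  have M: "maximal_ideal_filter M"
    using \<psi>(1) by (simp add: \<Omega>_max_def M_def)
  have MI: "A \<in> M \<longleftrightarrow> \<chi> A = 1" if "A \<in> I" for A
    using \<psi>(2) that I by (auto simp: M_def)
  have "\<exists>Y\<in>G. z Y \<in> M \<and> c Y \<inter> M = {}"
  proof (rule ccontr)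
    assume neg: "\<not> ?thesis"
    have "X \<in> M" using MI[of X] \<chi>(2) by (simp add: I_def)
    moreover have "(\<exists>A\<in>M. A \<inter> B = {}) \<or> B \<in> constructible_ideals - M" if "B \<in> F \<union> G" for B
    proof (cases "B \<in> F")
      case True
      then show ?thesis
        using MI[of B] \<chi>(3) F by (auto simp: I_def)
    next
      case False
      with that have B: "B \<in> G" by simp
      show ?thesis
      \<comment> \<open>Either an ideal removed from \<open>z B\<close> belongs to \<open>M\<close>,
        or \<open>z B\<close> is outside \<open>M\<close> and hence missed by a member of
        \<open>M\<close>.\<close>
      proof (cases "z B \<in> M")
        case True
        then obtain A where A: "A \<in> c B" "A \<in> M"
          using neg B by blast
        moreover from A have "A \<inter> B = {}"
          by (subst eq[OF B]) blast
        ultimately show ?thesis by blast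
      next
        case False
        then obtain A where "A \<in> M" "A \<inter> z B = {}"
          using maximal_ideal_filter_disjoint[OF M zc(1)[OF B]] by blast
        moreover from this have "A \<inter> B = {}"
          by (subst eq[OF B]) blast
        ultimately show ?thesis by blast
      qed
    qed
    ultimately obtain Y where Y: "Y \<in> M" "Y \<subseteq> X" "\<And>B. B \<in> F \<union> G \<Longrightarrow> Y \<inter> B = {}"
      using maximal_ideal_filter_avoids[OF M, of X "F \<union> G"] fin by auto
    moreover have "ideal_filter M"
      using M by (simp add: maximal_ideal_filter_def)
    ultimately have "Y \<in> constructible_ideals" "Y \<noteq> {}"
      using ideal_filterD(2,3) by blast+
    then have "\<exists>Z\<in>F \<union> G. Y \<inter> Z \<noteq> {}"
      using fs Y(2) by (simp add: foundation_set_def)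
    with Y(3) show False by blast
  qed
  then obtain Y where Y: "Y \<in> G" "z Y \<in> M" "c Y \<inter> M = {}" by blast
  have "\<chi> A = 0" if "A \<in> c Y" for A
  proof -
    have "A \<in> I" "A \<in> constructible_ideals" using that Y(1) zc(3)[of Y] by (auto simp: I_def)
    moreover have "\<chi> \<in> characters"
      using \<chi>(1) boundary_subset_Omega Omega_subset_characters by auto
    ultimately show ?thesis
      using MI[of A] Y(3) that characters_value by blast
  qed
  moreover have "\<chi> (z Y) = 1"
    using MI[of "z Y"] Y by (simp add: I_def)
  ultimately have "char_extension \<chi> Y = 1"
    unfolding char_extension_eq_1 using zc Y(1) eq[OF Y(1)]
    by (intro exI[of _ "z Y"] exI[of _ "c Y"]) blast
  with Y(1) show ?thesis by blast
qed

section \<open>Germs and the quotient map\<close>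

text \<open>The ideals presenting \<open>E\<close> join \<open>I\<close>; a point realizing
  \<open>\<chi>\<close> on this larger finite set lies in \<open>E\<close>. Values of
  \<open>\<chi>\<close> can thus be compared at points of \<open>E\<close>.\<close>

lemma char_extension_points:
  assumes \<chi>: "\<chi> \<in> \<Omega>" and E: "char_extension \<chi> E = 1"
    and I: "finite I" "I \<subseteq> constructible_ideals"
  obtains s where "(s :: 'a) \<in> E" "\<And>X. X \<in> I \<Longrightarrow> \<chi> X = of_bool (s \<in> X)"
proof -
  obtain X F where XF: "X \<in> constructible_ideals" "finite F" "F \<subseteq> constructible_ideals"
      "E = X - \<Union>F" "\<chi> X = 1" "\<forall>Z\<in>F. \<chi> Z = 0"
    using E by (auto simp only: char_extension_eq_1)
  have "finite (insert X (F \<union> I))" "insert X (F \<union> I) \<subseteq> constructible_ideals"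
    using XF I by auto
  moreover have "\<forall>I. finite I \<longrightarrow> I \<subseteq> constructible_ideals \<longrightarrow> (\<exists>s. \<forall>A\<in>I. of_bool (s \<in> A) = \<chi> A)"
    by (rule \<chi>[unfolded mem_Omega_iff, THEN conjunct2])
  ultimately obtain s where s: "\<forall>A\<in>insert X (F \<union> I). of_bool (s \<in> A) = \<chi> A"
    by meson
  have "of_bool (s \<in> X) = (1::nat)" "\<And>Z. Z \<in> F \<Longrightarrow> of_bool (s \<in> Z) = (0::nat)"
    using s XF(5,6) by simp_all
  then have "s \<in> X" "\<forall>Z\<in>F. s \<notin> Z"
    unfolding of_bool_eq_1_iff by simp_all
  with s XF show thesis
    by (intro that[of s]) auto
qed

lemma char_extension_Int:
  assumes \<chi>: "\<chi> \<in> characters"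
    and "char_extension \<chi> D = 1" "char_extension \<chi> E = 1"
  shows "char_extension \<chi> (D \<inter> E :: 'a set) = 1" "D \<inter> E \<in> constructible_differences"
proof -
  obtain X F where XF: "X \<in> constructible_ideals" "finite F" "F \<subseteq> constructible_ideals"
      "D = X - \<Union>F" "\<chi> X = 1" "\<forall>Z\<in>F. \<chi> Z = 0"
    using assms(2) by (auto simp only: char_extension_eq_1)
  obtain X' F' where XF': "X' \<in> constructible_ideals" "finite F'" "F' \<subseteq> constructible_ideals"
      "E = X' - \<Union>F'" "\<chi> X' = 1" "\<forall>Z\<in>F'. \<chi> Z = 0"
    using assms(3) by (auto simp only: char_extension_eq_1)
  have *: "X \<inter> X' \<in> constructible_ideals" "finite (F \<union> F')" "F \<union> F' \<subseteq> constructible_ideals"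
    "D \<inter> E = X \<inter> X' - \<Union>(F \<union> F')" "\<chi> (X \<inter> X') = 1" "\<forall>Z\<in>F \<union> F'. \<chi> Z = 0"
    using XF XF' Int_constructible characters_Int[OF \<chi>] by auto
  then show "char_extension \<chi> (D \<inter> E) = 1"
    unfolding char_extension_eq_1 by (intro exI conjI)
  show "D \<inter> E \<in> constructible_differences"
    unfolding *(4) by (rule constructible_difference[OF *(1-3)])
qed

text \<open>\<open>germ_rel\<close> is reflexive at \<open>(g, \<chi>)\<close>, with witness
  \<open>dom g\<close>, so this pair lies in its own germ and hence in that of
  \<open>(h, \<psi>)\<close>.\<close>

lemma germ_eqD:
  assumes "(g, \<chi>) \<in> germ_pairs" "germ (g :: 'a \<rightharpoonup> 'a) \<chi> = germ h \<psi>"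
  shows "\<chi> = \<psi>" "\<exists>A\<in>constructible_ideals. \<chi> A = 1 \<and> g |` A = h |` A"
proof -
  have "\<chi> (dom g) = 1" "dom g \<in> constructible_ideals"
    using assms(1) dom_constructible by (auto simp: germ_pairs_def)
  then have "((g, \<chi>), (g, \<chi>)) \<in> germ_rel"
    using assms(1) by (auto simp: germ_rel_def intro!: bexI[of _ "dom g"])
  then have "((h, \<psi>), (g, \<chi>)) \<in> germ_rel"
    using assms(2) unfolding germ_def by blast
  then obtain A where A: "\<psi> = \<chi>" "A \<in> constructible_ideals" "\<psi> A = 1" "h |` A = g |` A"
    unfolding germ_rel_def by blast
  show "\<chi> = \<psi>"
    by (rule A(1)[symmetric])
  show "\<exists>A\<in>constructible_ideals. \<chi> A = 1 \<and> g |` A = h |` A"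
    using A(2-4) unfolding A(1) by (intro bexI[of _ A] conjI) simp_all
qed

text \<open>\<open>G_rel\<close> allows any representative of a germ; passing to \<open>g\<close>
  costs an ideal \<open>A\<close> of value 1, absorbed by intersecting it with
  \<open>X\<close>.\<close>

lemma G_rel_germ_iff:
  assumes g: "(g, \<chi>) \<in> germ_pairs"
  shows "(germ (g :: 'a \<rightharpoonup> 'a) \<chi>, \<gamma>) \<in> G_rel \<longleftrightarrow>
    (\<exists>h. \<gamma> = germ h \<chi> \<and> (h, \<chi>) \<in> germ_pairs \<and>
      (\<exists>X\<in>constructible_differences. char_extension \<chi> X = 1 \<and> g |` X = h |` X))"
    (is "?L \<longleftrightarrow> ?R")
proof
  assume ?L
  then obtain g' h \<psi> X where *: "germ g \<chi> = germ g' \<psi>" "\<gamma> = germ h \<psi>" "(h, \<psi>) \<in> germ_pairs"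
      "X \<in> constructible_differences" "char_extension \<psi> X = 1" "g' |` X = h |` X"
    unfolding G_rel_def by blast
  have \<psi>: "\<psi> = \<chi>" using germ_eqD(1)[OF g *(1)] by simp
  obtain A where A: "A \<in> constructible_ideals" "\<chi> A = 1" "g |` A = g' |` A"
    using germ_eqD(2)[OF g *(1)] by blast
  have "\<chi> \<in> characters"
    using g Omega_subset_characters by (auto simp: germ_pairs_def)
  note AX = char_extension_Int[OF this char_extension_ideal[of A \<chi>, OF A(1,2)] *(5)[unfolded \<psi>]]
  have "g |` (A \<inter> X) = h |` (A \<inter> X)"
    using restrict_map_eq_mono[OF A(3), of "A \<inter> X"] restrict_map_eq_mono[OF *(6), of "A \<inter> X"]
    by simp
  with AX * \<psi> show ?R by blast
next
  assume ?R
  with g show ?L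
    unfolding G_rel_def by blast
qed

text \<open>Transitivity: agreement on \<open>X\<close> and on \<open>Y\<close> gives agreement on
  \<open>X \<inter> Y\<close>, whose value is still 1.\<close>

lemma G_quotient_map_eq:
  assumes "(g, \<chi>) \<in> germ_pairs" "(h, \<chi>) \<in> germ_pairs"
    and X: "char_extension \<chi> X = 1" "(g :: 'a \<rightharpoonup> 'a) |` X = h |` X"
  shows "G_quotient_map (germ g \<chi>) = G_quotient_map (germ h \<chi>)"
proof -
  have \<chi>: "\<chi> \<in> characters"
    using assms(1) Omega_subset_characters by (auto simp: germ_pairs_def)
  have sub: "G_quotient_map (germ g \<chi>) \<subseteq> G_quotient_map (germ h \<chi>)"
    if g: "(g, \<chi>) \<in> germ_pairs" and h: "(h, \<chi>) \<in> germ_pairs" and gh: "g |` X = h |` X"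
    for g h :: "'a \<rightharpoonup> 'a"
  proof
    fix \<gamma>
    assume "\<gamma> \<in> G_quotient_map (germ g \<chi>)"
    then obtain k Y where k: "\<gamma> = germ k \<chi>" "(k, \<chi>) \<in> germ_pairs"
        "Y \<in> constructible_differences" "char_extension \<chi> Y = 1" "g |` Y = k |` Y"
      using G_rel_germ_iff[OF g] by (auto simp: G_quotient_map_def)
    have "h |` (X \<inter> Y) = k |` (X \<inter> Y)"
      using restrict_map_eq_mono[OF gh, of "X \<inter> Y"] restrict_map_eq_mono[OF k(5), of "X \<inter> Y"]
      by simp
    with char_extension_Int[OF \<chi> X(1) k(4)] k(1,2) show "\<gamma> \<in> G_quotient_map (germ h \<chi>)"
      using G_rel_germ_iff[OF h] by (auto simp: G_quotient_map_def)
  qed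
  show ?thesis
    using sub[OF assms(1,2)] sub[OF assms(2,1)] X(2) by auto
qed

section \<open>From constructible differences to constructible ideals\<close>

text \<open>Here injectivity of the quotient map enters. It concerns germs in the boundary reduction
  only, so the range characters must be identified too.\<close>

lemma fixed_on_ideal:
  assumes equal: "boundary_groupoids_equal TYPE('a)"
    and h: "h \<in> I_l" and \<chi>: "\<chi> \<in> boundary_\<Omega>"
    and E: "char_extension \<chi> E = 1" "\<And>y. y \<in> E \<Longrightarrow> h y = Some (y :: 'a)"
  obtains A where "A \<in> constructible_ideals" "\<chi> A = 1" "\<And>y. y \<in> A \<Longrightarrow> h y = Some y"
proof -
  have \<chi>\<Omega>: "\<chi> \<in> \<Omega>" using \<chi> boundary_subset_Omega by auto
  then have \<chi>c: "\<chi> \<in> characters" using Omega_subset_characters by auto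
  have range: "range_char g \<chi> = \<chi>" if g: "g \<in> I_l" "\<And>y. y \<in> E \<Longrightarrow> g y = Some y" for g
  proof
    fix X
    show "range_char g \<chi> X = \<chi> X"
    proof (cases "X \<in> constructible_ideals")
      case True
      let ?V = "{s. \<exists>t\<in>X. g s = Some t}"
      \<comment> \<open>Since \<open>g\<close> fixes \<open>s\<close>, membership of
        \<open>s\<close> in \<open>X\<close> and in \<open>?V\<close> is the same.\<close>
      obtain s where "s \<in> E" "\<And>Z. Z \<in> {X, ?V} \<Longrightarrow> \<chi> Z = of_bool (s \<in> Z)"
        using char_extension_points[OF \<chi>\<Omega> E(1), of "{X, ?V}"] True
          preimage_constructible[OF g(1) True] by auto
      then show ?thesis
        using True g(2) by (simp add: range_char_def)
    next
      case False
      \<comment> \<open>Off the constructible ideals both functions are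
        \<open>undefined\<close>.\<close>
      then show ?thesis
        using \<chi>c by (auto simp: range_char_def characters_def PiE_iff extensional_def)
    qed
  qed
  have pairs: "(g, \<chi>) \<in> germ_pairs" if g: "g \<in> I_l" "\<And>y. y \<in> E \<Longrightarrow> g y = Some y" for g
  proof -
    obtain s where "s \<in> E" "\<chi> (dom g) = of_bool (s \<in> dom g)"
      using char_extension_points[OF \<chi>\<Omega> E(1), of "{dom g}"] dom_constructible[OF g(1)] by auto
    then show ?thesis
      using g \<chi>\<Omega> by (auto simp: germ_pairs_def)
  qed
  note h' = pairs[OF h E(2)] range[OF h E(2)]
  note id' = pairs[OF Some_in_I_l refl] range[OF Some_in_I_l refl]
  have "h |` E = Some |` E"
    using E(2) by (auto simp: restrict_map_def)
  then have "G_quotient_map (germ h \<chi>) = G_quotient_map (germ Some \<chi>)"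
    using G_quotient_map_eq[OF h'(1) id'(1) E(1)] by simp
  moreover have "germ h \<chi> \<in> boundary_G_P" "germ Some \<chi> \<in> boundary_G_P"
    unfolding boundary_G_P_def using h' id' \<chi> by fastforce+
  ultimately have "germ h \<chi> = germ Some \<chi>"
    using equal by (auto simp: boundary_groupoids_equal_def inj_on_def)
  then obtain A where A: "A \<in> constructible_ideals" "\<chi> A = 1" "h |` A = Some |` A"
    using germ_eqD(2)[OF h'(1)] by blast
  have "h y = Some y" if "y \<in> A" for y
    using fun_cong[OF A(3), of y] that by simp
  with A show thesis by (intro that)
qed

text \<open>Compactness selects finitely many conditions. The character of a maximal filter around
  \<open>Y\<close> satisfies one of them, which names an ideal of that filter, and this ideal meets
  \<open>Y\<close>.\<close>

lemma foundation_set_of_boundary_cover: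
  assumes X: "(X :: 'a set) \<in> constructible_ideals"
    and F: "finite F" "F \<subseteq> constructible_ideals" "\<And>Z. Z \<in> F \<Longrightarrow> Z \<subseteq> X"
    and \<A>: "\<A> \<subseteq> constructible_ideals"
    and cover: "\<And>\<chi>. \<chi> \<in> boundary_\<Omega> \<Longrightarrow> \<chi> X = 1 \<Longrightarrow> \<forall>Z\<in>F. \<chi> Z = 0 \<Longrightarrow> \<exists>A\<in>\<A>. \<chi> A = 1"
  obtains \<B> where "finite \<B>" "\<B> \<subseteq> \<A>" "foundation_set (F \<union> (\<inter>) X ` \<B>) X"
proof -
  \<comment> \<open>The premises of \<open>cover\<close> become part of the open cover: its members
    are \<open>\<chi> X = 0\<close> and \<open>\<chi> Z = 1\<close> for \<open>Z\<close> in
    \<open>F\<close> or \<open>\<A>\<close>.\<close>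
  define P :: "('a set \<times> nat) set" where "P = insert (X, 0) ((\<lambda>Z. (Z, 1)) ` (F \<union> \<A>))"
  have PJ: "fst ` P \<subseteq> constructible_ideals"
    using X F(2) \<A> by (auto simp: P_def)
  have "\<forall>\<chi>\<in>boundary_\<Omega>. \<exists>(Z, e)\<in>P. \<chi> Z = e"
  proof (intro ballI, rule ccontr)
    fix \<chi> :: "'a char"
    assume \<chi>: "\<chi> \<in> boundary_\<Omega>"
    assume "\<not> (\<exists>(Z, e)\<in>P. \<chi> Z = e)"
    then have neg: "\<chi> X \<noteq> 0" "\<And>Z. Z \<in> F \<Longrightarrow> \<chi> Z \<noteq> 1" "\<And>Z. Z \<in> \<A> \<Longrightarrow> \<chi> Z \<noteq> 1"
      by (auto simp: P_def)
    have "\<chi> \<in> characters"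
      using \<chi> boundary_subset_Omega Omega_subset_characters by auto
    from characters_value[OF this] have "\<chi> Z = 0" if "Z \<in> F" for Z
      using F(2) neg(2)[OF that] that by blast
    with characters_value[OF \<open>\<chi> \<in> characters\<close> X] neg(1) have "\<exists>A\<in>\<A>. \<chi> A = 1"
      by (intro cover[OF \<chi>]) simp_all
    with neg(3) show False by blast
  qed
  then obtain Q where Q: "finite Q" "Q \<subseteq> P" "\<forall>\<chi>\<in>boundary_\<Omega>. \<exists>(Z, e)\<in>Q. \<chi> Z = e"
    using boundary_finite_subcover[OF PJ] by blast
  define \<B> where "\<B> = fst ` Q \<inter> \<A>"
  have "F \<union> (\<inter>) X ` \<B> \<subseteq> constructible_ideals"
    using X F(2) \<A> Int_constructible by (auto simp: \<B>_def)
  then have "F \<union> (\<inter>) X ` \<B> \<subseteq> constructible_differences" "X \<in> constructible_differences"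
    using X constructible_ideals_subset_differences by blast+
  moreover have "\<exists>Z\<in>F \<union> (\<inter>) X ` \<B>. Y \<inter> Z \<noteq> {}"
    if Y: "Y \<in> constructible_ideals" "Y \<noteq> {}" "Y \<subseteq> X" for Y
  proof -
    obtain M where M: "maximal_ideal_filter M" "Y \<in> M"
      using exists_maximal_ideal_filter[OF Y(1,2)] .
    then have f: "ideal_filter M"
      by (simp add: maximal_ideal_filter_def)
    have "X \<in> M"
      using ideal_filterD(5)[OF f M(2) X Y(3)] .
    define \<chi> :: "'a char" where "\<chi> = (\<lambda>X\<in>constructible_ideals. of_bool (X \<in> M))"
    have "\<chi> \<in> boundary_\<Omega>"
      using maximal_ideal_filter_character[OF M(1)] Omega_max_subset_boundary by (auto simp: \<chi>_def)
    then obtain Z e where Z: "(Z, e) \<in> Q" "\<chi> Z = e"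
      using Q(3) by blast
    have "\<chi> X = 1"
      using X \<open>X \<in> M\<close> by (simp add: \<chi>_def)
    \<comment> \<open>The selected pair is not \<open>(X, 0)\<close>, because
      \<open>\<chi> X = 1\<close>.\<close>
    then have FA: "Z \<in> F \<union> \<A>" and "\<chi> Z = 1"
      using Z Q(2) by (auto simp: P_def)
    moreover have "\<chi> Z = of_bool (Z \<in> M)"
      using FA F(2) \<A> by (auto simp: \<chi>_def)
    ultimately have "Z \<in> M" by (cases "Z \<in> M") simp_all
    then have "Y \<inter> Z \<in> M"
      by (rule ideal_filterD(4)[OF f M(2)])
    \<comment> \<open>Members of \<open>\<A>\<close> may stick out of \<open>X\<close>; cutting them
      down to \<open>X\<close> does not change what they share with \<open>Y\<close>.\<close>
    then have YZ: "Y \<inter> Z \<noteq> {}" "Y \<inter> (X \<inter> Z) = Y \<inter> Z"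
      using ideal_filterD(3)[OF f] Y(3) by auto
    show ?thesis
    proof (cases "Z \<in> F")
      case True
      with YZ(1) show ?thesis by (intro bexI[of _ Z]) simp_all
    next
      case False
      then have "Z \<in> \<B>"
        using FA imageI[OF Z(1), of fst] by (simp add: \<B>_def)
      with YZ show ?thesis by (intro bexI[of _ "X \<inter> Z"]) simp_all
    qed
  qed
  moreover have "finite (F \<union> (\<inter>) X ` \<B>)" "\<forall>Z\<in>F \<union> (\<inter>) X ` \<B>. Z \<subseteq> X"
    using F(1,3) Q(1) by (auto simp: \<B>_def)
  ultimately have "foundation_set (F \<union> (\<inter>) X ` \<B>) X"
    unfolding foundation_set_def by (intro conjI ballI impI) simp_all
  then show thesis
    using Q(1) by (intro that) (auto simp: \<B>_def)
qed

lemma strongly_regular_of_regular: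
  assumes regular: "cstar_regular_on_boundary TYPE('a)"
    and equal: "boundary_groupoids_equal TYPE('a)"
  shows "strongly_cstar_regular_on_boundary TYPE('a)"
  unfolding strongly_cstar_regular_on_boundary_def regular_on_boundary_with_def
proof (intro allI impI)
  fix H :: "('a \<rightharpoonup> 'a) set" and X :: "'a set" and F :: "'a set set"
  assume H: "finite H" "H \<subseteq> I_l"
    and X: "X \<in> constructible_ideals"
    and F: "finite F" "F \<subseteq> constructible_ideals" "\<forall>Z\<in>F. Z \<subseteq> X"
    and XF: "X - \<Union>F \<noteq> {}" "X - \<Union>F \<subseteq> (\<Union>h\<in>H. {s. h s = Some s})"
  from regular[unfolded cstar_regular_on_boundary_def regular_on_boundary_with_def,
      THEN spec[of _ H], THEN spec[of _ X], THEN spec[of _ F]] H X F XF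
  obtain G where G: "\<forall>Y\<in>G. \<exists>h\<in>H. \<forall>y\<in>Y. h y = Some y" "foundation_set (F \<union> G) X"
    by (elim impE exE conjE)
  \<comment> \<open>Possibly infinite; the cover lemma extracts the finite subfamily.\<close>
  define \<A> where "\<A> = {A \<in> constructible_ideals. \<exists>h\<in>H. \<forall>y\<in>A. h y = Some y}"
  have "\<exists>A\<in>\<A>. \<chi> A = 1" if \<chi>: "\<chi> \<in> boundary_\<Omega>" "\<chi> X = 1" "\<forall>Z\<in>F. \<chi> Z = 0" for \<chi>
  proof -
    obtain Y where Y: "Y \<in> G" "char_extension \<chi> Y = 1"
      using foundation_set_boundary[OF G(2) X F(2) \<chi>(1,2)] \<chi>(3) by blast
    then obtain h where h: "h \<in> H" "\<And>y. y \<in> Y \<Longrightarrow> h y = Some y"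
      using G(1) by blast
    obtain A where "A \<in> constructible_ideals" "\<chi> A = 1" "\<And>y. y \<in> A \<Longrightarrow> h y = Some y"
      using fixed_on_ideal[OF equal subsetD[OF H(2) h(1)] \<chi>(1) Y(2) h(2)] by metis
    with h(1) show ?thesis
      by (intro bexI[of _ A]) (auto simp: \<A>_def)
  qed
  then obtain \<B> where \<B>: "finite \<B>" "\<B> \<subseteq> \<A>" "foundation_set (F \<union> (\<inter>) X ` \<B>) X"
    using foundation_set_of_boundary_cover[OF X F(1,2), of \<A>] F(3)
    by (auto simp: \<A>_def)
  \<comment> \<open>Cutting with \<open>X\<close> preserves both constructibility and being fixed
    pointwise.\<close>
  have "(\<inter>) X ` \<B> \<subseteq> constructible_ideals"
    using \<B>(2) X Int_constructible by (auto simp: \<A>_def)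
  moreover have "\<forall>Y\<in>(\<inter>) X ` \<B>. \<exists>h\<in>H. \<forall>y\<in>Y. h y = Some y"
    using \<B>(2) by (fastforce simp: \<A>_def)
  ultimately show "\<exists>G. finite G \<and> G \<subseteq> constructible_ideals \<and>
      (\<forall>Y\<in>G. \<exists>h\<in>H. \<forall>y\<in>Y. h y = Some y) \<and> foundation_set (F \<union> G) X"
    using \<B>(1,3) by blast
qed

end

theorem proposition4p2:
  assumes left_cancellative: "\<And>s t t' :: 'a::monoid_mult. s * t = s * t' \<Longrightarrow> t = t'"
    and regular: "cstar_regular_on_boundary TYPE('a)"
    and equal: "boundary_groupoids_equal TYPE('a)"
  shows "strongly_cstar_regular_on_boundary TYPE('a)"
  by (rule strongly_regular_of_regular[OF _ regular equal]) (rule left_cancellative)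

end
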